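(* Let $(A,\mu,\Delta,\delta_1,\delta_2)$ be a compatible covariant bialgebra. Then $(A,\diamond)$ is a (left) pre-Lie algebra, where $a\diamond b=b_{(1)}\,a\,b_{(2)}$ for $a,b\in A$ with $\Delta(b)=b_{(1)}\otimes b_{(2)}$ (implicit summation).
   Context: All vector spaces are over a field of characteristic zero. For an associative algebra $A$, $A\otimes A$ is an $A$-bimodule via $a\cdot(b\otimes c)=ab\otimes c$, $(b\otimes c)\cdot a=b\otimes ca$. A covariant bialgebra is a tuple $(A,\mu,\Delta,\delta_1,\delta_2)$ where $(A,\mu)$ is an associative algebra, $(A,\Delta)$ is a coassociative coalgebra, $\delta_1,\delta_2:A\to A\otimes A$ are derivations ($\delta_i(ab)=a\cdot\delta_i(b)+\delta_i(a)\cdot b$), and $\Delta(ab)=a\cdot\delta_1(b)+\Delta(a)\cdot b=a\cdot\Delta(b)+\delta_2(a)\cdot b$ for all $a,b\in A$. It is compatible if $(\mathrm{id}\otimes\delta_1)\circ\Delta=(\delta_2\otimes\mathrm{id})\circ\Delta$. A (left) pre-Lie algebra is a vector space $L$ with a bilinear operation $\diamond$ satisfying $(a\diamond b)\diamond c-a\diamond(b\diamond c)=(b\diamond a)\diamond c-b\diamond(a\diamond c)$. *)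

theory Defs
  imports Complex_Main "HOL-Library.Poly_Mapping"
begin

section \<open>Formal linear combinations\<close>

text \<open>
  \<open>'i \<Rightarrow>\<^sub>0 'k\<close> is the free vector space over the field \<open>'k\<close> on the set of all elements of \<open>'i\<close>;
  the basis vector belonging to \<open>i\<close> is \<open>basis i\<close>.
\<close>

abbreviation basis :: "'i \<Rightarrow> ('i \<Rightarrow>\<^sub>0 'k::field)" where
  "basis i \<equiv> Poly_Mapping.single i 1"

definition free_scale :: "'k::field \<Rightarrow> ('i \<Rightarrow>\<^sub>0 'k) \<Rightarrow> ('i \<Rightarrow>\<^sub>0 'k)" where
  "free_scale c x = Poly_Mapping.map ((*) c) x"

lemma lookup_free_scale [simp]: "Poly_Mapping.lookup (free_scale c x) i = c * Poly_Mapping.lookup x i"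
  unfolding free_scale_def by transfer (simp add: when_def)

interpretation free: vector_space free_scale
  by unfold_locales (auto intro!: poly_mapping_eqI simp: lookup_add algebra_simps)

definition linear_extension ::
    "('k::field \<Rightarrow> 'v \<Rightarrow> 'v::ab_group_add) \<Rightarrow> ('i \<Rightarrow> 'v) \<Rightarrow> ('i \<Rightarrow>\<^sub>0 'k) \<Rightarrow> 'v" where
  "linear_extension s f x = (\<Sum>i\<in>Poly_Mapping.keys x. s (Poly_Mapping.lookup x i) (f i))"

lemma linear_linear_extension:
  fixes s :: "'k::field \<Rightarrow> 'v \<Rightarrow> 'v::ab_group_add" and f :: "'i \<Rightarrow> 'v"
  assumes "vector_space s"
  shows "Vector_Spaces.linear free_scale s (linear_extension s f)"
proof -
  interpret vector_space s by fact
  have ext: "linear_extension s f x = (\<Sum>i\<in>I. s (Poly_Mapping.lookup x i) (f i))"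
    if "finite I" "Poly_Mapping.keys x \<subseteq> I" for x I
    unfolding linear_extension_def using that
    by (intro sum.mono_neutral_left) (auto simp: in_keys_iff)
  show ?thesis
  proof (unfold_locales)
    fix x y :: "'i \<Rightarrow>\<^sub>0 'k"
    let ?I = "Poly_Mapping.keys x \<union> Poly_Mapping.keys y"
    have "Poly_Mapping.keys (x + y) \<subseteq> ?I" by (rule Poly_Mapping.keys_add)
    then show "linear_extension s f (x + y) = linear_extension s f x + linear_extension s f y"
      by (simp add: ext[of ?I] lookup_add scale_left_distrib sum.distrib)
  next
    fix c :: 'k and x :: "'i \<Rightarrow>\<^sub>0 'k"
    have "Poly_Mapping.keys (free_scale c x) \<subseteq> Poly_Mapping.keys x" by (auto simp: in_keys_iff)
    then show "linear_extension s f (free_scale c x) = s c (linear_extension s f x)"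
      by (simp add: ext[of "Poly_Mapping.keys x"] scale_sum_right)
  qed
qed

lemma linear_extension_single:
  assumes "vector_space s"
  shows "linear_extension s f (Poly_Mapping.single i c) = s c (f i)"
proof -
  interpret vector_space s by fact
  show ?thesis by (simp add: linear_extension_def)
qed


section \<open>The tensor products \<open>A \<otimes> A\<close> and \<open>A \<otimes> A \<otimes> A\<close>\<close>

text \<open>
  A vector space is a type \<open>'a\<close> together with a scalar multiplication \<open>s\<close>.  Because the tensor
  product depends on \<open>s\<close>, it is not a type but a set of cosets: \<open>A \<otimes> A\<close> is the free vector space on
  \<open>'a \<times> 'a\<close> modulo the subspace generated by the bilinearity relations, and \<open>A \<otimes> A \<otimes> A\<close> is the
  free vector space on triples modulo the trilinearity relations.
\<close>

inductive_set bilinear_relations :: "('k::field \<Rightarrow> 'a \<Rightarrow> 'a::ab_group_add) \<Rightarrow> ('a \<times> 'a \<Rightarrow>\<^sub>0 'k) set"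
  for s :: "'k::field \<Rightarrow> 'a \<Rightarrow> 'a::ab_group_add" where
  "basis (a + a', b) - basis (a, b) - basis (a', b) \<in> bilinear_relations s"
| "basis (a, b + b') - basis (a, b) - basis (a, b') \<in> bilinear_relations s"
| "basis (s r a, b) - free_scale r (basis (a, b)) \<in> bilinear_relations s"
| "basis (a, s r b) - free_scale r (basis (a, b)) \<in> bilinear_relations s"

inductive_set trilinear_relations ::
    "('k::field \<Rightarrow> 'a \<Rightarrow> 'a::ab_group_add) \<Rightarrow> ('a \<times> 'a \<times> 'a \<Rightarrow>\<^sub>0 'k) set"
  for s :: "'k::field \<Rightarrow> 'a \<Rightarrow> 'a::ab_group_add" where
  "basis (a + a', b, c) - basis (a, b, c) - basis (a', b, c) \<in> trilinear_relations s"
| "basis (a, b + b', c) - basis (a, b, c) - basis (a, b', c) \<in> trilinear_relations s"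
| "basis (a, b, c + c') - basis (a, b, c) - basis (a, b, c') \<in> trilinear_relations s"
| "basis (s r a, b, c) - free_scale r (basis (a, b, c)) \<in> trilinear_relations s"
| "basis (a, s r b, c) - free_scale r (basis (a, b, c)) \<in> trilinear_relations s"
| "basis (a, b, s r c) - free_scale r (basis (a, b, c)) \<in> trilinear_relations s"

definition coset :: "('i \<Rightarrow>\<^sub>0 'k::field) set \<Rightarrow> ('i \<Rightarrow>\<^sub>0 'k) \<Rightarrow> ('i \<Rightarrow>\<^sub>0 'k) set" where
  "coset R x = {y. y - x \<in> free.span R}"

text \<open>
  A formal sum representing a tensor.  It is only ever used as an argument of maps that do not
  depend on the choice of the representative.
\<close>

definition repr :: "('i \<Rightarrow>\<^sub>0 'k::field) set \<Rightarrow> ('i \<Rightarrow>\<^sub>0 'k)" where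
  "repr t = (SOME x. x \<in> t)"

abbreviation tensor2 ::
    "('k::field \<Rightarrow> 'a \<Rightarrow> 'a::ab_group_add) \<Rightarrow> ('a \<times> 'a \<Rightarrow>\<^sub>0 'k) \<Rightarrow> ('a \<times> 'a \<Rightarrow>\<^sub>0 'k) set" where
  "tensor2 s \<equiv> coset (bilinear_relations s)"

abbreviation tensor3 ::
    "('k::field \<Rightarrow> 'a \<Rightarrow> 'a::ab_group_add) \<Rightarrow> ('a \<times> 'a \<times> 'a \<Rightarrow>\<^sub>0 'k) \<Rightarrow> ('a \<times> 'a \<times> 'a \<Rightarrow>\<^sub>0 'k) set" where
  "tensor3 s \<equiv> coset (trilinear_relations s)"

definition tensor_square ::
    "('k::field \<Rightarrow> 'a \<Rightarrow> 'a::ab_group_add) \<Rightarrow> ('a \<times> 'a \<Rightarrow>\<^sub>0 'k) set set" where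
  "tensor_square s = {tensor2 s x | x. True}"

definition pure2 ::
    "('k::field \<Rightarrow> 'a \<Rightarrow> 'a::ab_group_add) \<Rightarrow> 'a \<Rightarrow> 'a \<Rightarrow> ('a \<times> 'a \<Rightarrow>\<^sub>0 'k) set" where
  "pure2 s a b = tensor2 s (basis (a, b))"

definition tensor_add ::
    "('k::field \<Rightarrow> 'a \<Rightarrow> 'a::ab_group_add) \<Rightarrow> ('a \<times> 'a \<Rightarrow>\<^sub>0 'k) set \<Rightarrow> ('a \<times> 'a \<Rightarrow>\<^sub>0 'k) set
      \<Rightarrow> ('a \<times> 'a \<Rightarrow>\<^sub>0 'k) set" where
  "tensor_add s t u = tensor2 s (repr t + repr u)"

definition tensor_scale ::
    "('k::field \<Rightarrow> 'a \<Rightarrow> 'a::ab_group_add) \<Rightarrow> 'k \<Rightarrow> ('a \<times> 'a \<Rightarrow>\<^sub>0 'k) set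
      \<Rightarrow> ('a \<times> 'a \<Rightarrow>\<^sub>0 'k) set" where
  "tensor_scale s c t = tensor2 s (free_scale c (repr t))"

definition tensor_linear ::
    "('k::field \<Rightarrow> 'a \<Rightarrow> 'a::ab_group_add) \<Rightarrow> ('a \<Rightarrow> ('a \<times> 'a \<Rightarrow>\<^sub>0 'k) set) \<Rightarrow> bool" where
  "tensor_linear s f \<longleftrightarrow>
     (\<forall>a. f a \<in> tensor_square s) \<and>
     (\<forall>a b. f (a + b) = tensor_add s (f a) (f b)) \<and>
     (\<forall>c a. f (s c a) = tensor_scale s c (f a))"

text \<open>The \<open>A\<close>-bimodule structure \<open>a \<cdot> (b \<otimes> c) = ab \<otimes> c\<close>, \<open>(b \<otimes> c) \<cdot> a = b \<otimes> ca\<close>.\<close>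

definition left_action ::
    "('k::field \<Rightarrow> 'a \<Rightarrow> 'a::ring) \<Rightarrow> 'a \<Rightarrow> ('a \<times> 'a \<Rightarrow>\<^sub>0 'k) set \<Rightarrow> ('a \<times> 'a \<Rightarrow>\<^sub>0 'k) set" where
  "left_action s a t =
     tensor2 s (linear_extension free_scale (\<lambda>(b, c). basis (a * b, c)) (repr t))"

definition right_action ::
    "('k::field \<Rightarrow> 'a \<Rightarrow> 'a::ring) \<Rightarrow> ('a \<times> 'a \<Rightarrow>\<^sub>0 'k) set \<Rightarrow> 'a \<Rightarrow> ('a \<times> 'a \<Rightarrow>\<^sub>0 'k) set" where
  "right_action s t a =
     tensor2 s (linear_extension free_scale (\<lambda>(b, c). basis (b, c * a)) (repr t))"

text \<open>
  The maps \<open>id \<otimes> f\<close> and \<open>f \<otimes> id\<close> from \<open>A \<otimes> A\<close> to \<open>A \<otimes> A \<otimes> A\<close>, for a linear \<open>f : A \<rightarrow> A \<otimes> A\<close>, with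
  \<open>a \<otimes> (c \<otimes> d)\<close> and \<open>(c \<otimes> d) \<otimes> b\<close> identified with \<open>a \<otimes> c \<otimes> d\<close> and \<open>c \<otimes> d \<otimes> b\<close>.
\<close>

definition id_tensor ::
    "('k::field \<Rightarrow> 'a \<Rightarrow> 'a::ab_group_add) \<Rightarrow> ('a \<Rightarrow> ('a \<times> 'a \<Rightarrow>\<^sub>0 'k) set)
      \<Rightarrow> ('a \<times> 'a \<Rightarrow>\<^sub>0 'k) set \<Rightarrow> ('a \<times> 'a \<times> 'a \<Rightarrow>\<^sub>0 'k) set" where
  "id_tensor s f t =
     tensor3 s (linear_extension free_scale
       (\<lambda>(a, b). linear_extension free_scale
          (\<lambda>(c, d). basis (a, c, d)) (repr (f b))) (repr t))"

definition tensor_id ::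
    "('k::field \<Rightarrow> 'a \<Rightarrow> 'a::ab_group_add) \<Rightarrow> ('a \<Rightarrow> ('a \<times> 'a \<Rightarrow>\<^sub>0 'k) set)
      \<Rightarrow> ('a \<times> 'a \<Rightarrow>\<^sub>0 'k) set \<Rightarrow> ('a \<times> 'a \<times> 'a \<Rightarrow>\<^sub>0 'k) set" where
  "tensor_id s f t =
     tensor3 s (linear_extension free_scale
       (\<lambda>(a, b). linear_extension free_scale
          (\<lambda>(c, d). basis (c, d, b)) (repr (f a))) (repr t))"


subsection \<open>Independence of representatives\<close>

lemma coset_eq_iff: "coset R x = coset R y \<longleftrightarrow> x - y \<in> free.span R"
proof
  assume "coset R x = coset R y"
  moreover have "x \<in> coset R x" by (simp add: coset_def free.span_zero)
  ultimately show "x - y \<in> free.span R" by (simp add: coset_def)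
next
  assume *: "x - y \<in> free.span R"
  have "z - x \<in> free.span R \<longleftrightarrow> z - y \<in> free.span R" for z
    using free.span_add_eq[OF *, of "z - x"] by (simp add: add.commute)
  then show "coset R x = coset R y" by (simp add: coset_def)
qed

lemma repr_coset: "repr (coset R x) - x \<in> free.span R"
proof -
  have "x \<in> coset R x" by (simp add: coset_def free.span_zero)
  then have "repr (coset R x) \<in> coset R x" unfolding repr_def by (rule someI)
  then show ?thesis by (simp add: coset_def)
qed

lemma coset_linear_repr:
  assumes "Vector_Spaces.linear free_scale free_scale g" and "\<And>x. x \<in> R \<Longrightarrow> g x \<in> free.span R'"
  shows "coset R' (g (repr (coset R x))) = coset R' (g x)"
proof -
  interpret g: Vector_Spaces.linear free_scale free_scale g by fact
  have "g y \<in> free.span R'" if "y \<in> free.span R" for y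
    using that
    by (induction rule: free.span_induct_alt)
      (auto simp: g.zero g.add g.scale assms free.span_zero free.span_add free.span_scale)
  from this[OF repr_coset[of R x]] show ?thesis by (simp add: coset_eq_iff g.diff)
qed

lemma tensor_add_coset: "tensor_add s (tensor2 s x) (tensor2 s y) = tensor2 s (x + y)"
proof -
  let ?R = "bilinear_relations s"
  have "(repr (coset ?R x) - x) + (repr (coset ?R y) - y) \<in> free.span ?R"
    by (intro free.span_add repr_coset)
  then show ?thesis by (simp add: tensor_add_def coset_eq_iff algebra_simps)
qed

lemma tensor_scale_coset: "tensor_scale s r (tensor2 s x) = tensor2 s (free_scale r x)"
proof -
  have "Vector_Spaces.linear free_scale free_scale (free_scale r)"
    by (intro free.linear_scale_self)
  then show ?thesis
    unfolding tensor_scale_def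
    by (rule coset_linear_repr) (intro free.span_scale free.span_base)
qed

lemma linear_linear_extension_free:
  "Vector_Spaces.linear free_scale free_scale (linear_extension free_scale f)"
  by (rule linear_linear_extension[OF free.vector_space_axioms])

lemma linear_extension_free_single:
  "linear_extension free_scale f (Poly_Mapping.single i c) = free_scale c (f i)"
  by (rule linear_extension_single[OF free.vector_space_axioms])

lemma linear_extension_free_diff:
  "linear_extension free_scale f (x - y) = linear_extension free_scale f x - linear_extension free_scale f y"
  and linear_extension_free_scale:
  "linear_extension free_scale f (free_scale c x) = free_scale c (linear_extension free_scale f x)"
proof -
  interpret Vector_Spaces.linear free_scale free_scale "linear_extension free_scale f"
    by (rule linear_linear_extension_free)
  show "linear_extension free_scale f (x - y) = linear_extension free_scale f x - linear_extension free_scale f y"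
    and "linear_extension free_scale f (free_scale c x) = free_scale c (linear_extension free_scale f x)"
    by (rule diff scale)+
qed

lemmas linear_extension_simps =
  linear_extension_free_single linear_extension_free_diff linear_extension_free_scale


section \<open>Covariant bialgebras and pre-Lie algebras\<close>

text \<open>Associative algebras need not have a unit, and coalgebras need not have a counit.\<close>

locale associative_algebra = vector_space scale
  for scale :: "'k::field_char_0 \<Rightarrow> 'a::ring \<Rightarrow> 'a" +
  assumes scale_mult_left: "scale r a * b = scale r (a * b)"
    and mult_scale_right: "a * scale r b = scale r (a * b)"

locale coassociative_coalgebra = vector_space scale
  for scale :: "'k::field_char_0 \<Rightarrow> 'a::ab_group_add \<Rightarrow> 'a" +
  fixes \<Delta> :: "'a \<Rightarrow> ('a \<times> 'a \<Rightarrow>\<^sub>0 'k) set"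
  assumes linear_comult: "tensor_linear scale \<Delta>"
    and coassoc: "tensor_id scale \<Delta> (\<Delta> a) = id_tensor scale \<Delta> (\<Delta> a)"

definition derivation :: "('k::field_char_0 \<Rightarrow> 'a \<Rightarrow> 'a::ring) \<Rightarrow> ('a \<Rightarrow> ('a \<times> 'a \<Rightarrow>\<^sub>0 'k) set) \<Rightarrow> bool" where
  "derivation s \<delta> \<longleftrightarrow> tensor_linear s \<delta> \<and>
     (\<forall>a b. \<delta> (a * b) = tensor_add s (left_action s a (\<delta> b)) (right_action s (\<delta> a) b))"

locale covariant_bialgebra =
  associative_algebra scale + coassociative_coalgebra scale \<Delta>
  for scale :: "'k::field_char_0 \<Rightarrow> 'a::ring \<Rightarrow> 'a"
    and \<Delta> \<delta>\<^sub>1 \<delta>\<^sub>2 :: "'a \<Rightarrow> ('a \<times> 'a \<Rightarrow>\<^sub>0 'k) set" +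
  assumes derivation_1: "derivation scale \<delta>\<^sub>1"
    and derivation_2: "derivation scale \<delta>\<^sub>2"
    and comult_mult_1:
      "\<Delta> (a * b) = tensor_add scale (left_action scale a (\<delta>\<^sub>1 b)) (right_action scale (\<Delta> a) b)"
    and comult_mult_2:
      "\<Delta> (a * b) = tensor_add scale (left_action scale a (\<Delta> b)) (right_action scale (\<delta>\<^sub>2 a) b)"

locale compatible_covariant_bialgebra = covariant_bialgebra +
  assumes compatible: "id_tensor scale \<delta>\<^sub>1 (\<Delta> a) = tensor_id scale \<delta>\<^sub>2 (\<Delta> a)"

locale left_pre_lie_algebra = vector_space scale
  for scale :: "'k::field_char_0 \<Rightarrow> 'a::ab_group_add \<Rightarrow> 'a" +
  fixes pre_lie :: "'a \<Rightarrow> 'a \<Rightarrow> 'a"  (infixl \<open>\<diamondop>\<close> 70)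
  assumes pre_lie_add_left: "(a + b) \<diamondop> c = a \<diamondop> c + b \<diamondop> c"
    and pre_lie_add_right: "a \<diamondop> (b + c) = a \<diamondop> b + a \<diamondop> c"
    and pre_lie_scale_left: "scale r a \<diamondop> b = scale r (a \<diamondop> b)"
    and pre_lie_scale_right: "a \<diamondop> scale r b = scale r (a \<diamondop> b)"
    and left_symmetric: "(a \<diamondop> b) \<diamondop> c - a \<diamondop> (b \<diamondop> c) = (b \<diamondop> a) \<diamondop> c - b \<diamondop> (a \<diamondop> c)"

text \<open>\<open>a \<diamondop> b = b\<^sub>(\<^sub>1\<^sub>) a b\<^sub>(\<^sub>2\<^sub>)\<close>, the image of \<open>\<Delta> b\<close> under the linear map \<open>A \<otimes> A \<rightarrow> A\<close>, \<open>x \<otimes> y \<mapsto> x a y\<close>.\<close>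

definition comult_product ::
    "('k::field_char_0 \<Rightarrow> 'a \<Rightarrow> 'a::ring) \<Rightarrow> ('a \<Rightarrow> ('a \<times> 'a \<Rightarrow>\<^sub>0 'k) set) \<Rightarrow> 'a \<Rightarrow> 'a \<Rightarrow> 'a" where
  "comult_product s \<Delta> a b = linear_extension s (\<lambda>(x, y). x * a * y) (repr (\<Delta> b))"


section \<open>The maps on tensors do not depend on representatives\<close>

lemma left_action_coset:
  assumes "associative_algebra s"
  shows "left_action s a (tensor2 s x) =
    tensor2 s (linear_extension free_scale (\<lambda>(b, c). basis (a * b, c)) x)"
proof -
  interpret associative_algebra s by fact
  show ?thesis
    unfolding left_action_def
  proof (rule coset_linear_repr[OF linear_linear_extension_free])
    fix x assume "x \<in> bilinear_relations s"
    then show "linear_extension free_scale (\<lambda>(b, c). basis (a * b, c)) x \<in> free.span (bilinear_relations s)"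
      by (intro free.span_base)
        (cases rule: bilinear_relations.cases,
          auto simp: linear_extension_simps mult_scale_right distrib_left intro: bilinear_relations.intros)
  qed
qed

lemma left_action_pure2:
  "associative_algebra s \<Longrightarrow> left_action s a (pure2 s b c) = pure2 s (a * b) c"
  by (simp add: pure2_def left_action_coset linear_extension_simps)

lemma right_action_coset:
  assumes "associative_algebra s"
  shows "right_action s (tensor2 s x) a =
    tensor2 s (linear_extension free_scale (\<lambda>(b, c). basis (b, c * a)) x)"
proof -
  interpret associative_algebra s by fact
  show ?thesis
    unfolding right_action_def
  proof (rule coset_linear_repr[OF linear_linear_extension_free])
    fix x assume "x \<in> bilinear_relations s"
    then show "linear_extension free_scale (\<lambda>(b, c). basis (b, c * a)) x \<in> free.span (bilinear_relations s)"
      by (intro free.span_base)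
        (cases rule: bilinear_relations.cases,
          auto simp: linear_extension_simps scale_mult_left distrib_right intro: bilinear_relations.intros)
  qed
qed

lemma right_action_pure2:
  "associative_algebra s \<Longrightarrow> right_action s (pure2 s b c) a = pure2 s b (c * a)"
  by (simp add: pure2_def right_action_coset linear_extension_simps)

lemma linear_extension_congruence:
  assumes "\<And>i. f i - g i - h i \<in> free.span R"
  shows "linear_extension free_scale f x - linear_extension free_scale g x
    - linear_extension free_scale h x \<in> free.span R"
  unfolding linear_extension_def sum_subtractf[symmetric] free.scale_right_diff_distrib[symmetric]
  by (intro free.span_sum free.span_scale assms)

lemma linear_extension_congruence_scale:
  assumes "\<And>i. f i - free_scale r (g i) \<in> free.span R"
  shows "linear_extension free_scale f x - free_scale r (linear_extension free_scale g x) \<in> free.span R"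
proof -
  have "linear_extension free_scale f x - free_scale r (linear_extension free_scale g x) =
      (\<Sum>i\<in>Poly_Mapping.keys x. free_scale (Poly_Mapping.lookup x i) (f i - free_scale r (g i)))"
    unfolding linear_extension_def
    by (simp add: sum_subtractf free.scale_right_diff_distrib free.scale_sum_right
        mult.commute)
  then show ?thesis by (simp add: free.span_sum free.span_scale assms)
qed

lemma linear_extension_span:
  assumes "x \<in> free.span R" and "\<And>x. x \<in> R \<Longrightarrow> linear_extension free_scale f x \<in> free.span R'"
  shows "linear_extension free_scale f x \<in> free.span R'"
proof -
  interpret g: Vector_Spaces.linear free_scale free_scale "linear_extension free_scale f"
    by (rule linear_linear_extension_free)
  from assms(1) show ?thesis
    by (induction rule: free.span_induct_alt)
      (auto simp: g.zero g.add g.scale assms(2) free.span_zero free.span_add free.span_scale)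
qed

lemma tensor_linear_repr:
  assumes "tensor_linear s f"
  shows "repr (f (a + b)) - repr (f a) - repr (f b) \<in> free.span (bilinear_relations s)"
    and "repr (f (s r a)) - free_scale r (repr (f a)) \<in> free.span (bilinear_relations s)"
proof -
  have "tensor2 s (repr (f c)) = f c" for c
  proof -
    obtain x where "f c = tensor2 s x"
      using assms unfolding tensor_linear_def tensor_square_def by blast
    then show ?thesis by (simp add: coset_eq_iff repr_coset)
  qed
  then have "tensor2 s (repr (f (a + b))) = tensor2 s (repr (f a) + repr (f b))"
    and "tensor2 s (repr (f (s r a))) = tensor2 s (free_scale r (repr (f a)))"
    using assms by (metis tensor_linear_def tensor_add_def, metis tensor_linear_def tensor_scale_def)
  then show "repr (f (a + b)) - repr (f a) - repr (f b) \<in> free.span (bilinear_relations s)"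
    and "repr (f (s r a)) - free_scale r (repr (f a)) \<in> free.span (bilinear_relations s)"
    by (simp_all add: coset_eq_iff algebra_simps)
qed

lemma id_tensor_coset:
  assumes "tensor_linear s f"
  shows "id_tensor s f (tensor2 s x) =
    tensor3 s (linear_extension free_scale
      (\<lambda>(a, b). linear_extension free_scale (\<lambda>(c, d). basis (a, c, d)) (repr (f b))) x)"
  unfolding id_tensor_def
proof (rule coset_linear_repr[OF linear_linear_extension_free])
  let ?T = "trilinear_relations s"
  have gen: "linear_extension free_scale (\<lambda>(c, d). basis (a, c, d)) y \<in> free.span ?T"
    if "y \<in> bilinear_relations s" for a y
    using that
    by (intro free.span_base)
      (cases rule: bilinear_relations.cases,
        auto simp: linear_extension_simps intro: trilinear_relations.intros)
  note sp = linear_extension_span[OF tensor_linear_repr(1)[OF assms] gen, unfolded linear_extension_simps]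
    linear_extension_span[OF tensor_linear_repr(2)[OF assms] gen, unfolded linear_extension_simps]
  have add: "linear_extension free_scale (\<lambda>(c, d). basis (a + a', c, d)) y -
      linear_extension free_scale (\<lambda>(c, d). basis (a, c, d)) y - linear_extension free_scale (\<lambda>(c, d). basis (a', c, d)) y \<in> free.span ?T" for a a' y
    by (rule linear_extension_congruence, intro free.span_base)
      (auto split: prod.split intro: trilinear_relations.intros)
  have scl: "linear_extension free_scale (\<lambda>(c, d). basis (s r a, c, d)) y -
      free_scale r (linear_extension free_scale (\<lambda>(c, d). basis (a, c, d)) y) \<in> free.span ?T" for r a y
    by (rule linear_extension_congruence_scale, intro free.span_base)
      (auto split: prod.split intro: trilinear_relations.intros)
  fix x assume "x \<in> bilinear_relations s"
  then show "linear_extension free_scale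
      (\<lambda>(a, b). linear_extension free_scale (\<lambda>(c, d). basis (a, c, d)) (repr (f b))) x \<in> free.span ?T"
    by cases (auto simp: linear_extension_simps sp add scl)
qed

lemma tensor_id_coset:
  assumes "tensor_linear s f"
  shows "tensor_id s f (tensor2 s x) =
    tensor3 s (linear_extension free_scale
      (\<lambda>(a, b). linear_extension free_scale (\<lambda>(c, d). basis (c, d, b)) (repr (f a))) x)"
  unfolding tensor_id_def
proof (rule coset_linear_repr[OF linear_linear_extension_free])
  let ?T = "trilinear_relations s"
  have gen: "linear_extension free_scale (\<lambda>(c, d). basis (c, d, b)) y \<in> free.span ?T"
    if "y \<in> bilinear_relations s" for b y
    using that
    by (intro free.span_base)
      (cases rule: bilinear_relations.cases,
        auto simp: linear_extension_simps intro: trilinear_relations.intros)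
  note sp = linear_extension_span[OF tensor_linear_repr(1)[OF assms] gen, unfolded linear_extension_simps]
    linear_extension_span[OF tensor_linear_repr(2)[OF assms] gen, unfolded linear_extension_simps]
  have add: "linear_extension free_scale (\<lambda>(c, d). basis (c, d, b + b')) y -
      linear_extension free_scale (\<lambda>(c, d). basis (c, d, b)) y - linear_extension free_scale (\<lambda>(c, d). basis (c, d, b')) y \<in> free.span ?T" for b b' y
    by (rule linear_extension_congruence, intro free.span_base)
      (auto split: prod.split intro: trilinear_relations.intros)
  have scl: "linear_extension free_scale (\<lambda>(c, d). basis (c, d, s r b)) y -
      free_scale r (linear_extension free_scale (\<lambda>(c, d). basis (c, d, b)) y) \<in> free.span ?T" for r b y
    by (rule linear_extension_congruence_scale, intro free.span_base)
      (auto split: prod.split intro: trilinear_relations.intros)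
  fix x assume "x \<in> bilinear_relations s"
  then show "linear_extension free_scale
      (\<lambda>(a, b). linear_extension free_scale (\<lambda>(c, d). basis (c, d, b)) (repr (f a))) x \<in> free.span ?T"
    by cases (auto simp: linear_extension_simps sp add scl)
qed

lemma comult_product_coset:
  assumes "associative_algebra s" and "\<Delta> b = tensor2 s x"
  shows "comult_product s \<Delta> a b = linear_extension s (\<lambda>(x, y). x * a * y) x"
proof -
  interpret associative_algebra s by fact
  let ?g = "linear_extension s (\<lambda>(x, y). x * a * y)"
  interpret g: Vector_Spaces.linear free_scale s ?g
    by (intro linear_linear_extension vector_space_axioms)
  have gen: "?g y = 0" if "y \<in> bilinear_relations s" for y
    using that
    by cases (auto simp: g.diff g.scale linear_extension_single[OF vector_space_axioms]
        scale_mult_left mult_scale_right distrib_left distrib_right)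
  have "?g y = 0" if "y \<in> free.span (bilinear_relations s)" for y
    using that by (induction rule: free.span_induct_alt) (auto simp: g.zero g.add g.scale gen)
  from this[OF repr_coset[of "bilinear_relations s" x]] show ?thesis
    by (simp add: comult_product_def assms(2) g.diff)
qed

end

theory Submission
  imports Defs
begin

text \<open>
  Expanding \<open>\<Delta> ((x b) y)\<close> with the first product rule for the outer product and the second one for
  the inner product gives \<open>x b \<cdot> \<delta>\<^sub>1 y + x \<cdot> \<Delta> b \<cdot> y + \<delta>\<^sub>2 x \<cdot> b y\<close>.  For \<open>x \<otimes> y = \<Delta> c\<close>, the middle
  term contributes \<open>(a \<diamondop> b) \<diamondop> c\<close> to \<open>a \<diamondop> (b \<diamondop> c)\<close>.  The two outer terms are the images of
  \<open>(id \<otimes> \<delta>\<^sub>1) (\<Delta> c)\<close> under \<open>x \<otimes> y \<otimes> z \<mapsto> x b y a z\<close> and of \<open>(\<delta>\<^sub>2 \<otimes> id) (\<Delta> c)\<close> under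
  \<open>x \<otimes> y \<otimes> z \<mapsto> x a y b z\<close>, so compatibility makes their sum symmetric in \<open>a\<close> and \<open>b\<close>.
\<close>

lemma linear_extension_commute:
  assumes "Vector_Spaces.linear s s' f"
  shows "f (linear_extension s g x) = linear_extension s' (\<lambda>i. f (g i)) x"
proof -
  interpret Vector_Spaces.linear s s' f by fact
  show ?thesis by (simp add: linear_extension_def sum scale)
qed

lemma (in vector_space) linear_extension_add:
  "linear_extension scale (\<lambda>i. f i + g i) x = linear_extension scale f x + linear_extension scale g x"
  by (simp add: linear_extension_def scale_right_distrib sum.distrib)

text \<open>Takes an arbitrary tensor, so that it applies to the values of
  \<open>\<delta>\<^sub>1\<close> and \<open>\<delta>\<^sub>2\<close> as well as to those of
  \<open>\<Delta>\<close>.\<close>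

definition sandwich2 :: "('k::field \<Rightarrow> 'a \<Rightarrow> 'a::ring) \<Rightarrow> 'a \<Rightarrow> ('a \<times> 'a \<Rightarrow>\<^sub>0 'k) set \<Rightarrow> 'a" where
  "sandwich2 s a t = linear_extension s (\<lambda>(x, y). x * a * y) (repr t)"

text \<open>Compatibility is an equation between threefold tensors; this map carries it into the
  algebra.\<close>

definition sandwich3 ::
    "('k::field \<Rightarrow> 'a \<Rightarrow> 'a::ring) \<Rightarrow> 'a \<Rightarrow> 'a \<Rightarrow> ('a \<times> 'a \<times> 'a \<Rightarrow>\<^sub>0 'k) set \<Rightarrow> 'a" where
  "sandwich3 s a b t = linear_extension s (\<lambda>(x, y, z). x * a * y * b * z) (repr t)"

lemma comult_product_sandwich2: "comult_product s \<Delta> a b = sandwich2 s a (\<Delta> b)"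
  by (simp add: comult_product_def sandwich2_def)

context associative_algebra
begin

lemma linear_mult_left: "Vector_Spaces.linear scale scale ((*) a)"
  by unfold_locales (simp_all add: distrib_left mult_scale_right)

lemma linear_mult_right: "Vector_Spaces.linear scale scale (\<lambda>x. x * a)"
  by unfold_locales (simp_all add: distrib_right scale_mult_left)

lemma linear_linear_extension_scale:
  "Vector_Spaces.linear free_scale scale (linear_extension scale f)"
  by (intro linear_linear_extension vector_space_axioms)

lemma linear_extension_scale_single:
  "linear_extension scale f (Poly_Mapping.single i c) = scale c (f i)"
  by (intro linear_extension_single vector_space_axioms)

lemma linear_extension_scale_free:
  "linear_extension scale f (linear_extension free_scale g x) =
    linear_extension scale (\<lambda>i. linear_extension scale f (g i)) x"
  by (rule linear_extension_commute[OF linear_linear_extension_scale])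

lemma sandwich2_coset:
  "sandwich2 scale a (tensor2 scale x) = linear_extension scale (\<lambda>(x, y). x * a * y) x"
  \<comment> \<open>A constant map in the role of \<open>\<Delta>\<close> makes the tensor
    arbitrary.\<close>
  using comult_product_coset[OF associative_algebra_axioms, of "\<lambda>_. tensor2 scale x"]
  by (simp add: comult_product_sandwich2)

text \<open>The linear extension kills every trilinear relation, hence their span, so all
  representatives give the same value.\<close>

lemma sandwich3_coset:
  "sandwich3 scale a b (tensor3 scale x) = linear_extension scale (\<lambda>(x, y, z). x * a * y * b * z) x"
proof -
  let ?g = "linear_extension scale (\<lambda>(x, y, z). x * a * y * b * z)"
  interpret g: Vector_Spaces.linear free_scale scale ?g
    by (rule linear_linear_extension_scale)
  have gen: "?g y = 0" if "y \<in> trilinear_relations scale" for y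
    using that
    by cases (auto simp: g.diff g.scale linear_extension_scale_single
        scale_mult_left mult_scale_right distrib_left distrib_right)
  have "?g y = 0" if "y \<in> free.span (trilinear_relations scale)" for y
    using that by (induction rule: free.span_induct_alt) (auto simp: g.zero g.add g.scale gen)
  from this[OF repr_coset[of "trilinear_relations scale" x]] show ?thesis
    by (simp add: sandwich3_def g.diff)
qed

lemma sandwich2_tensor_add:
  "sandwich2 scale a (tensor_add scale t u) = sandwich2 scale a t + sandwich2 scale a u"
proof -
  interpret g: Vector_Spaces.linear free_scale scale "linear_extension scale (\<lambda>(x, y). x * a * y)"
    by (rule linear_linear_extension_scale)
  \<comment> \<open>\<open>sandwich2_def\<close> waits for the second \<open>simp\<close>: unfolded
    earlier, it would hide the coset from \<open>sandwich2_coset\<close>.\<close>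
  show ?thesis by (simp add: tensor_add_def sandwich2_coset g.add) (simp add: sandwich2_def)
qed

lemma sandwich2_tensor_scale:
  "sandwich2 scale a (tensor_scale scale r t) = scale r (sandwich2 scale a t)"
proof -
  interpret g: Vector_Spaces.linear free_scale scale "linear_extension scale (\<lambda>(x, y). x * a * y)"
    by (rule linear_linear_extension_scale)
  show ?thesis by (simp add: tensor_scale_def sandwich2_coset g.scale) (simp add: sandwich2_def)
qed

lemma sandwich2_left_action:
  "sandwich2 scale a (left_action scale b t) = b * sandwich2 scale a t"
  by (simp add: left_action_def sandwich2_coset linear_extension_scale_free)
    (simp add: sandwich2_def case_prod_unfold linear_extension_scale_single mult.assoc
      linear_extension_commute[OF linear_mult_left])

lemma sandwich2_right_action:
  "sandwich2 scale a (right_action scale t b) = sandwich2 scale a t * b"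
  by (simp add: right_action_def sandwich2_coset linear_extension_scale_free)
    (simp add: sandwich2_def case_prod_unfold linear_extension_scale_single mult.assoc
      linear_extension_commute[OF linear_mult_right])

lemma linear_sandwich2:
  assumes "tensor_linear scale f"
  shows "Vector_Spaces.linear scale scale (\<lambda>x. sandwich2 scale a (f x))"
  using assms unfolding tensor_linear_def
  by unfold_locales (simp_all add: sandwich2_tensor_add sandwich2_tensor_scale)

text \<open>Since \<open>f\<close> splits the second factor, associativity groups \<open>a\<close>
  with the two parts of \<open>f y\<close> and leaves \<open>b\<close> outside.\<close>

lemma sandwich3_id_tensor:
  "sandwich3 scale b a (id_tensor scale f t) =
    linear_extension scale (\<lambda>(x, y). x * b * sandwich2 scale a (f y)) (repr t)"
  by (simp add: id_tensor_def sandwich3_coset linear_extension_scale_free case_prod_unfold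
      linear_extension_scale_single sandwich2_def mult.assoc
      linear_extension_commute[OF linear_mult_left])

lemma sandwich3_tensor_id:
  "sandwich3 scale a b (tensor_id scale f t) =
    linear_extension scale (\<lambda>(x, y). sandwich2 scale a (f x) * b * y) (repr t)"
  by (simp add: tensor_id_def sandwich3_coset linear_extension_scale_free case_prod_unfold
      linear_extension_scale_single sandwich2_def mult.assoc
      linear_extension_commute[OF linear_mult_right])

text \<open>With \<open>t\<close> a value of \<open>\<Delta>\<close>, this is linearity of the
  pre-Lie product in its left argument.\<close>

lemma linear_sandwich2_middle: "Vector_Spaces.linear scale scale (\<lambda>a. sandwich2 scale a t)"
  by unfold_locales
    (simp_all add: sandwich2_def linear_extension_def case_prod_unfold distrib_left distrib_right
      scale_right_distrib sum.distrib scale_mult_left mult_scale_right scale_sum_right mult.commute)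

end

context covariant_bialgebra
begin

lemma sandwich2_comult_mult:
  "sandwich2 scale a (\<Delta> (x * b * y)) =
    x * b * sandwich2 scale a (\<delta>\<^sub>1 y) + x * sandwich2 scale a (\<Delta> b) * y
      + sandwich2 scale a (\<delta>\<^sub>2 x) * b * y"
  \<comment> \<open>Both rules rewrite the coproduct of any product; the instances fix which one
    splits off \<open>y\<close> and which one splits \<open>x * b\<close>.\<close>
  unfolding comult_mult_1[of "x * b"] comult_mult_2[of x b]
  by (simp add: sandwich2_tensor_add sandwich2_left_action sandwich2_right_action distrib_right
      add.assoc)

lemma comult_product_associator:
  fixes a b c
  defines "D \<equiv> comult_product scale \<Delta>"
  shows "D a (D b c) = sandwich3 scale b a (id_tensor scale \<delta>\<^sub>1 (\<Delta> c)) + D (D a b) c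
    + sandwich3 scale a b (tensor_id scale \<delta>\<^sub>2 (\<Delta> c))"
proof -
  have "D a (D b c) =
      linear_extension scale (\<lambda>(x, y). sandwich2 scale a (\<Delta> (x * b * y))) (repr (\<Delta> c))"
    \<comment> \<open>Only the sandwich around \<open>b\<close> is opened, so the outer one, linear
      through \<open>\<Delta>\<close>, moves under the sum.\<close>
    unfolding D_def comult_product_sandwich2 sandwich2_def[of _ b]
      linear_extension_commute[OF linear_sandwich2[OF linear_comult]]
    by (simp add: case_prod_unfold)
  then show ?thesis
    \<comment> \<open>The restricted instance of \<open>sandwich2_def\<close> opens just
      \<open>D (D a b) c\<close>, to match the middle sum.\<close>
    by (simp add: sandwich2_comult_mult case_prod_unfold linear_extension_add sandwich3_id_tensor
        sandwich3_tensor_id D_def comult_product_sandwich2 sandwich2_def[of _ "sandwich2 _ _ _"])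
qed

end

theorem proposition5p8:
  fixes scale :: "'k::field_char_0 \<Rightarrow> 'a::ring \<Rightarrow> 'a"
    and \<Delta> \<delta>\<^sub>1 \<delta>\<^sub>2 :: "'a \<Rightarrow> ('a \<times> 'a \<Rightarrow>\<^sub>0 'k) set"
  assumes "compatible_covariant_bialgebra scale \<Delta> \<delta>\<^sub>1 \<delta>\<^sub>2"
  shows "left_pre_lie_algebra scale (comult_product scale \<Delta>)"
proof -
  interpret compatible_covariant_bialgebra scale \<Delta> \<delta>\<^sub>1 \<delta>\<^sub>2 by fact
  interpret right: Vector_Spaces.linear scale scale "\<lambda>b. comult_product scale \<Delta> a b" for a
    unfolding comult_product_sandwich2 by (rule linear_sandwich2[OF linear_comult])
  interpret left: Vector_Spaces.linear scale scale "\<lambda>a. comult_product scale \<Delta> a b" for b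
    unfolding comult_product_sandwich2 by (rule linear_sandwich2_middle)
  show ?thesis
    by unfold_locales
      (simp_all add: left.add left.scale right.add right.scale comult_product_associator compatible)
qed

end
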